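(* Let $n$ be a positive integer and $\alpha$ a real number with $n+\alpha>0$ and $n+2\alpha>0$. Let $x_1<x_2<\cdots$ be the consecutive zeros of the ultraspherical polynomial $P_n^{(\alpha,\alpha)}$ in $(-1,1)$, let $\Delta x_k=x_{k+1}-x_k$, and put $$F(t)=\frac{-(\alpha+n)(\alpha+n+1)t^2+(1+n+n^2+\alpha+2\alpha n)}{(t^2-1)^2}.$$ If $|\alpha|\le 1$, then the zeros of $P_n^{(\alpha,\alpha)}$ on $(-1,0)$ are convex and those on $(0,1)$ are concave. In addition, $$\Delta x_k<\frac{\pi}{\sqrt{F(0)}}=\frac{\pi}{\sqrt{2\alpha n+\alpha+n^2+n+1}}$$ for all pairs of consecutive zeros $x_k,x_{k+1}$ in $(-1,1)$, and for the positive zeros (i.e. whenever $0<x_k<x_{k+1}$) we have $$\frac{\pi}{\sqrt{F(x_{k+1})}}<\Delta x_k<\frac{\pi}{\sqrt{F(x_k)}}.$$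
   Context: $P_n^{(\alpha,\alpha)}$ is the Jacobi polynomial with equal parameters (ultraspherical polynomial), defined for all real $\alpha$ by $$P_n^{(\alpha,\alpha)}(t)=\sum_{s=0}^{n}\binom{n+\alpha}{n-s}\binom{n+\alpha}{s}\left(\frac{t-1}{2}\right)^{s}\left(\frac{t+1}{2}\right)^{n-s};$$ it satisfies $(1-t^2)x''-(2\alpha+2)t\,x'+n(n+2\alpha+1)x=0$. Convexity convention: the zeros of a function on an interval $(a,b)$, listed in increasing order (only those lying in $(a,b)$), are called convex on $(a,b)$ if $x_{k+2}-x_{k+1}>x_{k+1}-x_k$ for every three consecutive zeros $x_k<x_{k+1}<x_{k+2}$ in $(a,b)$, and concave on $(a,b)$ if $x_{k+2}-x_{k+1}<x_{k+1}-x_k$ for every three consecutive zeros in $(a,b)$. *)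

theory Defs
  imports Complex_Main
begin

definition ultraspherical :: "nat \<Rightarrow> real \<Rightarrow> real \<Rightarrow> real" where
  "ultraspherical n \<alpha> t =
     (\<Sum>s=0..n. ((real n + \<alpha>) gchoose (n - s)) * ((real n + \<alpha>) gchoose s)
        * ((t - 1) / 2) ^ s * ((t + 1) / 2) ^ (n - s))"

text \<open>
  The enumeration of the zeros in increasing order is expressed by adjacency: \<open>x\<close> and \<open>y\<close> occupy
  positions \<open>k\<close> and \<open>k + 1\<close> in the list of zeros in \<open>(a, b)\<close> when no zero lies strictly between.
\<close>
definition consecutive_zeros :: "(real \<Rightarrow> real) \<Rightarrow> real \<Rightarrow> real \<Rightarrow> real \<Rightarrow> real \<Rightarrow> bool" where
  "consecutive_zeros f a b x y \<longleftrightarrow>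
     x \<in> {a<..<b} \<and> y \<in> {a<..<b} \<and> f x = 0 \<and> f y = 0 \<and> x < y \<and> (\<forall>z\<in>{x<..<y}. f z \<noteq> 0)"

definition zeros_convex_on :: "(real \<Rightarrow> real) \<Rightarrow> real \<Rightarrow> real \<Rightarrow> bool" where
  "zeros_convex_on f a b \<longleftrightarrow>
     (\<forall>x y z. consecutive_zeros f a b x y \<and> consecutive_zeros f a b y z \<longrightarrow> z - y > y - x)"

definition zeros_concave_on :: "(real \<Rightarrow> real) \<Rightarrow> real \<Rightarrow> real \<Rightarrow> bool" where
  "zeros_concave_on f a b \<longleftrightarrow>
     (\<forall>x y z. consecutive_zeros f a b x y \<and> consecutive_zeros f a b y z \<longrightarrow> z - y < y - x)"

definition F :: "nat \<Rightarrow> real \<Rightarrow> real \<Rightarrow> real" where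
  "F n \<alpha> t =
     (- (\<alpha> + real n) * (\<alpha> + real n + 1) * t\<^sup>2 + (1 + real n + (real n)\<^sup>2 + \<alpha> + 2 * \<alpha> * real n))
       / (t\<^sup>2 - 1)\<^sup>2"

end

theory Submission
  imports Defs
begin

text \<open>
  The weighted polynomial \<open>u(t) = (1 - t\<^sup>2)\<^bsup>(\<alpha>+1)/2\<^esup> P(t)\<close> has the same zeros in \<open>(-1, 1)\<close>
  as the ultraspherical polynomial \<open>P\<close>, and the weight is exactly the one that removes the
  first-order term from the ultraspherical differential equation: \<open>u'' + F u = 0\<close>
  (\<open>normal_form\<close>). Over an interval between two consecutive zeros, Sturm comparison with
  \<open>v'' + K v = 0\<close>, whose zeros are \<open>\<pi> / sqrt K\<close> apart, bounds the gap from below when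
  \<open>F < K\<close> there (\<open>sturm_gap_gt\<close>) and from above when \<open>F > K\<close> (\<open>sturm_gap_lt\<close>).

  Everything therefore rests on the shape of \<open>F\<close>. In partial fractions
  \<open>F(t) = D / (1 - t\<^sup>2) + (1 - \<alpha>\<^sup>2) / (1 - t\<^sup>2)\<^sup>2\<close> with \<open>D = (n + \<alpha>) (n + \<alpha> + 1) > 0\<close>, so
  \<open>\<bar>\<alpha>\<bar> \<le> 1\<close> makes \<open>F\<close> positive and strictly increasing in \<open>\<bar>t\<bar>\<close> on \<open>(-1, 1)\<close>
  (\<open>F_strict_mono_abs\<close>).
  Comparison with the constants \<open>F 0\<close>, \<open>F x\<close> and \<open>F y\<close> gives the three bounds on a gap. For three
  consecutive zeros \<open>x < y < z\<close> on one side of the origin, \<open>F y\<close> separates the values of \<open>F\<close>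
  on \<open>(x, y)\<close> from those on \<open>(y, z)\<close>, so \<open>\<pi> / sqrt (F y)\<close> separates the two gaps; this is
  the convexity or concavity of the zeros.
\<close>

section \<open>The ultraspherical differential equation\<close>

definition ultraspherical_coeff :: "nat \<Rightarrow> real \<Rightarrow> nat \<Rightarrow> real" where
  "ultraspherical_coeff n \<alpha> s = ((real n + \<alpha>) gchoose (n - s)) * ((real n + \<alpha>) gchoose s)"

definition endpoint_monomial :: "nat \<Rightarrow> nat \<Rightarrow> real \<Rightarrow> real" where
  "endpoint_monomial s m t = ((t - 1) / 2) ^ s * ((t + 1) / 2) ^ m"

lemma ultraspherical_eq_sum_monomials:
  "ultraspherical n \<alpha> t = (\<Sum>s\<le>n. ultraspherical_coeff n \<alpha> s * endpoint_monomial s (n - s) t)"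
  unfolding ultraspherical_def ultraspherical_coeff_def endpoint_monomial_def
  by (simp add: atLeast0AtMost mult.assoc)

text \<open>
  The ratio of consecutive coefficients comes from absorption in both binomial coefficients. It is
  stated without denominators because \<open>s + 1 + \<alpha>\<close> may vanish, as it does for \<open>\<alpha> = -1\<close> and
  \<open>s = 0\<close>.
\<close>

lemma ultraspherical_coeff_Suc:
  assumes "s < n"
  shows "ultraspherical_coeff n \<alpha> (Suc s) * (real (Suc s) * (real (Suc s) + \<alpha>))
       = ultraspherical_coeff n \<alpha> s * ((real n - real s) * (real n - real s + \<alpha>))"
proof -
  define a where "a = real n + \<alpha>"
  define m where "m = n - Suc s"
  have n: "n = Suc (s + m)" and ns: "n - s = Suc m"
    using assms by (auto simp: m_def)
  have 1: "(a gchoose Suc s) * real (Suc s) = (a gchoose s) * (a - real s)"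
    using gbinomial_absorb_comp[of a s] gbinomial_absorption[of s a]
    by (simp add: mult.commute)
  have 2: "(a gchoose Suc m) * real (Suc m) = (a gchoose m) * (a - real m)"
    using gbinomial_absorb_comp[of a m] gbinomial_absorption[of m a]
    by (simp add: mult.commute)
  have 3: "a - real m = real (Suc s) + \<alpha>" "real n - real s = real (Suc m)"
      "real n - real s + \<alpha> = a - real s"
    by (auto simp: a_def n)
  have "ultraspherical_coeff n \<alpha> (Suc s) * (real (Suc s) * (real (Suc s) + \<alpha>))
      = ((a gchoose m) * (a - real m)) * ((a gchoose Suc s) * real (Suc s))"
    unfolding ultraspherical_coeff_def a_def[symmetric] m_def[symmetric] 3(1)[symmetric]
    by (simp only: mult_ac)
  also have "\<dots> = ((a gchoose Suc m) * real (Suc m)) * ((a gchoose s) * (a - real s))"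
    by (simp only: 1 2)
  also have "\<dots> = ultraspherical_coeff n \<alpha> s * ((real n - real s) * (real n - real s + \<alpha>))"
    unfolding ultraspherical_coeff_def a_def[symmetric] ns 3(3) unfolding 3(2)
    by (simp only: mult_ac)
  finally show ?thesis .
qed

definition endpoint_monomial_deriv :: "nat \<Rightarrow> nat \<Rightarrow> real \<Rightarrow> real" where
  "endpoint_monomial_deriv s m t =
     (real s * endpoint_monomial (s - 1) m t + real m * endpoint_monomial s (m - 1) t) / 2"

definition endpoint_monomial_deriv2 :: "nat \<Rightarrow> nat \<Rightarrow> real \<Rightarrow> real" where
  "endpoint_monomial_deriv2 s m t =
     (real s * endpoint_monomial_deriv (s - 1) m t + real m * endpoint_monomial_deriv s (m - 1) t) / 2"

lemma has_derivative_endpoint_monomial: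
  "(endpoint_monomial s m has_real_derivative endpoint_monomial_deriv s m t) (at t)"
  unfolding endpoint_monomial_def[abs_def] endpoint_monomial_deriv_def
  by (auto intro!: derivative_eq_intros simp: algebra_simps)

lemma has_derivative_endpoint_monomial_deriv:
  "(endpoint_monomial_deriv s m has_real_derivative endpoint_monomial_deriv2 s m t) (at t)"
  unfolding endpoint_monomial_deriv_def[of s m, abs_def] endpoint_monomial_deriv2_def
  by (auto intro!: derivative_eq_intros has_derivative_endpoint_monomial)

text \<open>
  In the variables \<open>X = (t - 1) / 2\<close> and \<open>Y = (t + 1) / 2\<close> one has \<open>1 - t\<^sup>2 = - 4 X Y\<close> and
  \<open>t = X + Y\<close>, so the ultraspherical differential operator preserves homogeneity in \<open>X, Y\<close>:
  it sends \<open>X\<^sup>s Y\<^sup>m\<close> to a combination of itself and its two neighbours of the same degree. The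
  differential equation thereby becomes a three-term identity between coefficients.
\<close>

lemma ultraspherical_term_operator:
  assumes "s + m = n"
  shows "(1 - t\<^sup>2) * endpoint_monomial_deriv2 s m t
       - (2 * \<alpha> + 2) * t * endpoint_monomial_deriv s m t
       + real n * (real n + 2 * \<alpha> + 1) * endpoint_monomial s m t
     = (real s * (real s + \<alpha>) + real m * (real m + \<alpha>)) * endpoint_monomial s m t
       - real s * (real s + \<alpha>) * endpoint_monomial (s - 1) (m + 1) t
       - real m * (real m + \<alpha>) * endpoint_monomial (s + 1) (m - 1) t"
proof -
  define X where "X = (t - 1) / 2"
  define Y where "Y = (t + 1) / 2"
  have t: "t = X + Y" "1 - t\<^sup>2 = - 4 * X * Y"
    by (auto simp: X_def Y_def power2_eq_square field_simps)
  have n: "real n = real s + real m"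
    using assms by auto
  have e: "endpoint_monomial i j t = X ^ i * Y ^ j" for i j
    by (simp add: endpoint_monomial_def X_def Y_def)
  \<comment> \<open>Truncated exponents occur only below a factor that vanishes with them, which the case
      distinction makes visible.\<close>
  have s: "s = 0 \<or> s = 1 \<or> (\<exists>i. s = Suc (Suc i))" and m: "m = 0 \<or> m = 1 \<or> (\<exists>i. m = Suc (Suc i))"
    by presburger+
  show ?thesis
    unfolding t(2) n endpoint_monomial_deriv_def endpoint_monomial_deriv2_def e
    unfolding t(1)
    using s m by (elim disjE exE; simp; simp add: field_simps power2_eq_square)
qed

definition ultraspherical_deriv :: "nat \<Rightarrow> real \<Rightarrow> real \<Rightarrow> real" where
  "ultraspherical_deriv n \<alpha> t =
     (\<Sum>s\<le>n. ultraspherical_coeff n \<alpha> s * endpoint_monomial_deriv s (n - s) t)"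

definition ultraspherical_deriv2 :: "nat \<Rightarrow> real \<Rightarrow> real \<Rightarrow> real" where
  "ultraspherical_deriv2 n \<alpha> t =
     (\<Sum>s\<le>n. ultraspherical_coeff n \<alpha> s * endpoint_monomial_deriv2 s (n - s) t)"

lemma has_derivative_ultraspherical:
  "(ultraspherical n \<alpha> has_real_derivative ultraspherical_deriv n \<alpha> t) (at t)"
  unfolding ultraspherical_eq_sum_monomials[abs_def] ultraspherical_deriv_def
  by (intro DERIV_sum DERIV_cmult has_derivative_endpoint_monomial)

lemma has_derivative_ultraspherical_deriv:
  "(ultraspherical_deriv n \<alpha> has_real_derivative ultraspherical_deriv2 n \<alpha> t) (at t)"
  unfolding ultraspherical_deriv_def[abs_def] ultraspherical_deriv2_def
  by (intro DERIV_sum DERIV_cmult has_derivative_endpoint_monomial_deriv)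

text \<open>
  After applying the operator termwise, the contributions from the left and right neighbours are
  reindexed; by \<open>ultraspherical_coeff_Suc\<close> they cancel the diagonal contributions.
\<close>

lemma ultraspherical_ode:
  "(1 - t\<^sup>2) * ultraspherical_deriv2 n \<alpha> t - (2 * \<alpha> + 2) * t * ultraspherical_deriv n \<alpha> t
     + real n * (real n + 2 * \<alpha> + 1) * ultraspherical n \<alpha> t = 0"
proof -
  define c where "c = ultraspherical_coeff n \<alpha>"
  define e where "e s = endpoint_monomial s (n - s) t" for s
  define p where "p s = real s * (real s + \<alpha>)" for s
  have left: "(\<Sum>s\<le>n. c s * p s * endpoint_monomial (s - 1) (n - s + 1) t)
            = (\<Sum>s\<le>n. c s * p (n - s) * e s)"
  proof -
    have "(\<Sum>s\<le>n. c s * p s * endpoint_monomial (s - 1) (n - s + 1) t)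
        = (\<Sum>s<n. c (Suc s) * p (Suc s) * endpoint_monomial s (n - Suc s + 1) t)"
      by (simp add: sum.atMost_shift p_def)
    also have "\<dots> = (\<Sum>s<n. c s * p (n - s) * e s)"
    proof (rule sum.cong)
      fix s assume "s \<in> {..<n}"
      then show "c (Suc s) * p (Suc s) * endpoint_monomial s (n - Suc s + 1) t = c s * p (n - s) * e s"
        using ultraspherical_coeff_Suc[of s n \<alpha>]
        by (simp add: c_def p_def e_def of_nat_diff Suc_diff_Suc)
    qed simp
    also have "\<dots> = (\<Sum>s\<le>n. c s * p (n - s) * e s)"
      by (simp add: lessThan_Suc_atMost[symmetric] p_def)
    finally show ?thesis .
  qed
  have right: "(\<Sum>s\<le>n. c s * p (n - s) * endpoint_monomial (s + 1) (n - s - 1) t)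
             = (\<Sum>s\<le>n. c s * p s * e s)"
  proof -
    have "(\<Sum>s\<le>n. c s * p (n - s) * endpoint_monomial (s + 1) (n - s - 1) t)
        = (\<Sum>s<n. c s * p (n - s) * endpoint_monomial (s + 1) (n - s - 1) t)"
      by (simp add: lessThan_Suc_atMost[symmetric] p_def)
    also have "\<dots> = (\<Sum>s<n. c (Suc s) * p (Suc s) * e (Suc s))"
    proof (rule sum.cong)
      fix s assume "s \<in> {..<n}"
      then show "c s * p (n - s) * endpoint_monomial (s + 1) (n - s - 1) t
               = c (Suc s) * p (Suc s) * e (Suc s)"
        using ultraspherical_coeff_Suc[of s n \<alpha>]
        by (simp add: c_def p_def e_def of_nat_diff)
    qed simp
    also have "\<dots> = (\<Sum>s\<le>n. c s * p s * e s)"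
      by (simp add: sum.atMost_shift p_def)
    finally show ?thesis .
  qed
  have "(1 - t\<^sup>2) * ultraspherical_deriv2 n \<alpha> t - (2 * \<alpha> + 2) * t * ultraspherical_deriv n \<alpha> t
     + real n * (real n + 2 * \<alpha> + 1) * ultraspherical n \<alpha> t
    = (\<Sum>s\<le>n. c s * ((1 - t\<^sup>2) * endpoint_monomial_deriv2 s (n - s) t
       - (2 * \<alpha> + 2) * t * endpoint_monomial_deriv s (n - s) t
       + real n * (real n + 2 * \<alpha> + 1) * endpoint_monomial s (n - s) t))"
    unfolding ultraspherical_deriv2_def ultraspherical_deriv_def ultraspherical_eq_sum_monomials
      c_def sum_distrib_left sum_subtractf[symmetric] sum.distrib[symmetric]
    by (intro sum.cong) (simp_all add: algebra_simps)
  also have "\<dots> = (\<Sum>s\<le>n. c s * p s * e s + c s * p (n - s) * e s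
       - c s * p s * endpoint_monomial (s - 1) (n - s + 1) t
       - c s * p (n - s) * endpoint_monomial (s + 1) (n - s - 1) t)"
  proof (rule sum.cong)
    fix s assume "s \<in> {..n}"
    then have "s + (n - s) = n" by simp
    then show "c s * ((1 - t\<^sup>2) * endpoint_monomial_deriv2 s (n - s) t
       - (2 * \<alpha> + 2) * t * endpoint_monomial_deriv s (n - s) t
       + real n * (real n + 2 * \<alpha> + 1) * endpoint_monomial s (n - s) t)
      = c s * p s * e s + c s * p (n - s) * e s
       - c s * p s * endpoint_monomial (s - 1) (n - s + 1) t
       - c s * p (n - s) * endpoint_monomial (s + 1) (n - s - 1) t"
      unfolding ultraspherical_term_operator[OF \<open>s + (n - s) = n\<close>] e_def p_def
      by (simp only: right_diff_distrib distrib_left distrib_right mult.assoc)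
  qed simp
  also have "\<dots> = 0"
    unfolding sum_subtractf sum.distrib left right by simp
  finally show ?thesis .
qed

section \<open>Removing the first-order term\<close>

definition weighted_ultraspherical :: "nat \<Rightarrow> real \<Rightarrow> real \<Rightarrow> real" where
  "weighted_ultraspherical n \<alpha> t = (1 - t\<^sup>2) powr ((\<alpha> + 1) / 2) * ultraspherical n \<alpha> t"

text \<open>
  The factor \<open>- (\<alpha> + 1) t / (1 - t\<^sup>2)\<close> is the logarithmic derivative of the weight.
\<close>

definition weighted_ultraspherical_deriv :: "nat \<Rightarrow> real \<Rightarrow> real \<Rightarrow> real" where
  "weighted_ultraspherical_deriv n \<alpha> t = (1 - t\<^sup>2) powr ((\<alpha> + 1) / 2) *
     (ultraspherical_deriv n \<alpha> t - (\<alpha> + 1) * t / (1 - t\<^sup>2) * ultraspherical n \<alpha> t)"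

lemma one_minus_square_pos: "0 < 1 - t\<^sup>2" if "\<bar>t\<bar> < 1" for t :: real
  using that by (simp add: abs_square_less_1)

lemma has_derivative_weight:
  assumes "\<bar>t\<bar> < 1"
  shows "((\<lambda>t. (1 - t\<^sup>2) powr ((\<alpha> + 1) / 2)) has_real_derivative
           - ((\<alpha> + 1) * t / (1 - t\<^sup>2)) * (1 - t\<^sup>2) powr ((\<alpha> + 1) / 2)) (at t)"
proof -
  define e where "e = (\<alpha> + 1) / 2"
  have r: "1 - t\<^sup>2 > 0" by (rule one_minus_square_pos[OF assms])
  have "((\<lambda>t. 1 - t\<^sup>2) has_real_derivative - (2 * t)) (at t)"
    by (auto intro!: derivative_eq_intros)
  from DERIV_fun_powr[OF this r, of e] show ?thesis
    unfolding e_def[symmetric]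
    by (rule DERIV_cong) (use r in \<open>simp add: powr_diff\<close>, simp add: e_def)
qed

lemma has_derivative_weighted_ultraspherical:
  assumes "\<bar>t\<bar> < 1"
  shows "(weighted_ultraspherical n \<alpha> has_real_derivative weighted_ultraspherical_deriv n \<alpha> t) (at t)"
  unfolding weighted_ultraspherical_def[abs_def] weighted_ultraspherical_deriv_def
  by (rule DERIV_cong[OF DERIV_mult[OF has_derivative_weight[OF assms] has_derivative_ultraspherical]])
    (simp add: algebra_simps)

lemma F_numerator:
  "- (\<alpha> + real n) * (\<alpha> + real n + 1) * t\<^sup>2 + (1 + real n + (real n)\<^sup>2 + \<alpha> + 2 * \<alpha> * real n)
     = (\<alpha> + real n) * (\<alpha> + real n + 1) * (1 - t\<^sup>2) + (1 - \<alpha>\<^sup>2)"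
  by (simp add: algebra_simps power2_eq_square)

lemma F_partial_fractions:
  assumes "\<bar>t\<bar> < 1"
  shows "F n \<alpha> t = (\<alpha> + real n) * (\<alpha> + real n + 1) / (1 - t\<^sup>2) + (1 - \<alpha>\<^sup>2) / (1 - t\<^sup>2)\<^sup>2"
proof -
  have "(t\<^sup>2 - 1)\<^sup>2 = (1 - t\<^sup>2)\<^sup>2" by (rule power2_commute)
  then show ?thesis
    unfolding F_def F_numerator using one_minus_square_pos[OF assms]
    by (simp add: add_divide_distrib power2_eq_square)
qed

text \<open>
  The logarithmic derivative \<open>- g\<close> of the weight is half the coefficient of \<open>P'\<close> in the
  differential equation divided by \<open>1 - t\<^sup>2\<close>. Hence the terms in \<open>P'\<close> cancel, and the factor
  of \<open>P\<close> that remains is \<open>- F\<close>.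
\<close>

lemma normal_form:
  assumes "\<bar>t\<bar> < 1"
  shows "(weighted_ultraspherical_deriv n \<alpha> has_real_derivative
           - F n \<alpha> t * weighted_ultraspherical n \<alpha> t) (at t)"
proof -
  define r where "r = 1 - t\<^sup>2"
  define w where "w = r powr ((\<alpha> + 1) / 2)"
  define g where "g = (\<alpha> + 1) * t / r"
  define P where "P = ultraspherical n \<alpha> t"
  define P1 where "P1 = ultraspherical_deriv n \<alpha> t"
  define P2 where "P2 = ultraspherical_deriv2 n \<alpha> t"
  have r: "r > 0" using one_minus_square_pos[OF assms] by (simp add: r_def)
  have t2: "t\<^sup>2 = 1 - r" by (simp add: r_def)
  have dg: "((\<lambda>t. (\<alpha> + 1) * t / (1 - t\<^sup>2)) has_real_derivative (\<alpha> + 1) * (2 - r) / r\<^sup>2) (at t)"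
    using r unfolding r_def
    by (auto intro!: derivative_eq_intros simp: field_simps power2_eq_square)
  have d: "(weighted_ultraspherical_deriv n \<alpha> has_real_derivative
       (- g * w) * (P1 - g * P) + (P2 - ((\<alpha> + 1) * (2 - r) / r\<^sup>2 * P + P1 * g)) * w) (at t)"
    unfolding weighted_ultraspherical_deriv_def[abs_def] g_def w_def P_def P1_def P2_def
    using DERIV_mult[OF has_derivative_weight[OF assms] DERIV_diff[OF
        has_derivative_ultraspherical_deriv DERIV_mult[OF dg has_derivative_ultraspherical]]]
    by (simp add: r_def)
  have P2: "P2 = (2 * (\<alpha> + 1) * t * P1 - real n * (real n + 2 * \<alpha> + 1) * P) / r"
    using ultraspherical_ode[of t n \<alpha>] r
    by (simp add: r_def[symmetric] P_def[symmetric] P1_def[symmetric] P2_def[symmetric] field_simps)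
  have gg: "g * g = (\<alpha> + 1)\<^sup>2 * (1 - r) / r\<^sup>2"
    by (simp add: g_def t2[symmetric] power2_eq_square)
  have P2': "P2 - 2 * g * P1 = - (real n * (real n + 2 * \<alpha> + 1)) * P / r"
    unfolding P2 g_def using r by (simp add: field_simps)
  have q: "- (real n * (real n + 2 * \<alpha> + 1)) / r + g * g - (\<alpha> + 1) * (2 - r) / r\<^sup>2 = - F n \<alpha> t"
    unfolding F_partial_fractions[OF assms] gg r_def[symmetric] using r
    by (simp add: field_simps power2_eq_square)
  have "(- g * w) * (P1 - g * P) + (P2 - ((\<alpha> + 1) * (2 - r) / r\<^sup>2 * P + P1 * g)) * w
     = w * ((P2 - 2 * g * P1) + (g * g - (\<alpha> + 1) * (2 - r) / r\<^sup>2) * P)"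
    by (simp add: algebra_simps)
  also have "\<dots> = w * ((- (real n * (real n + 2 * \<alpha> + 1)) / r + g * g - (\<alpha> + 1) * (2 - r) / r\<^sup>2) * P)"
    unfolding P2' by (simp add: algebra_simps)
  also have "\<dots> = - F n \<alpha> t * weighted_ultraspherical n \<alpha> t"
    unfolding q by (simp add: weighted_ultraspherical_def w_def r_def P_def)
  finally show ?thesis using d by simp
qed

section \<open>Sturm comparison with constant coefficients\<close>

lemma nonvanishing_imp_constant_sign:
  fixes f :: "real \<Rightarrow> real"
  assumes "continuous_on {x<..<y} f" and "\<And>t. t \<in> {x<..<y} \<Longrightarrow> f t \<noteq> 0"
  obtains \<sigma> where "\<And>t. t \<in> {x<..<y} \<Longrightarrow> \<sigma> * f t > 0"
proof -
  have "connected (f ` {x<..<y})"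
    by (intro connected_continuous_image assms connected_Ioo)
  then have "(\<forall>t\<in>{x<..<y}. f t > 0) \<or> (\<forall>t\<in>{x<..<y}. f t < 0)"
    using assms(2) connectedD_interval[of "f ` {x<..<y}" _ _ 0]
    by (metis (no_types, lifting) image_iff linorder_neqE_linordered_idom order_less_imp_le)
  then show thesis
    using that[of 1] that[of "-1"] by auto
qed

text \<open>
  As long as \<open>u\<close> and the sine wave are both positive, their Wronskian is monotone in the
  direction given by the sign of \<open>k\<^sup>2 - q\<close>. This turns a pointwise comparison of the
  coefficients into a comparison of the zeros.
\<close>

lemma wronskian_sin_deriv:
  fixes u u' :: "real \<Rightarrow> real"
  assumes "(u has_real_derivative u' t) (at t)"
    and "(u' has_real_derivative - q * u t) (at t)"
  shows "((\<lambda>t. u' t * sin (k * (t - x)) - u t * (k * cos (k * (t - x)))) has_real_derivative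
           (k\<^sup>2 - q) * (u t * sin (k * (t - x)))) (at t)"
  by (rule derivative_eq_intros assms refl | simp add: algebra_simps power2_eq_square)+

text \<open>
  Take \<open>u > 0\<close> between its zeros. If the gap were at most \<open>\<pi> / sqrt K\<close>, the sine wave
  starting at \<open>x\<close> would be positive on \<open>(x, y)\<close> and the Wronskian would increase strictly
  from \<open>0\<close>; but at \<open>y\<close>, where \<open>u\<close> descends to zero, it is at most \<open>0\<close>.
\<close>

lemma sturm_gap_gt:
  fixes u u' q :: "real \<Rightarrow> real"
  assumes "x < y" and "K > 0"
    and du: "\<And>t. t \<in> {x..y} \<Longrightarrow> (u has_real_derivative u' t) (at t)"
    and du': "\<And>t. t \<in> {x..y} \<Longrightarrow> (u' has_real_derivative - q t * u t) (at t)"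
    and "u x = 0" and "u y = 0"
    and nz: "\<And>t. t \<in> {x<..<y} \<Longrightarrow> u t \<noteq> 0"
    and q: "\<And>t. t \<in> {x<..<y} \<Longrightarrow> q t < K"
  shows "pi / sqrt K < y - x"
proof (rule ccontr)
  define k where "k = sqrt K"
  have k: "k > 0" "k\<^sup>2 = K" using \<open>K > 0\<close> by (auto simp: k_def)
  assume "\<not> pi / sqrt K < y - x"
  then have short: "k * (y - x) \<le> pi"
    using k by (simp add: k_def[symmetric] field_simps)
  have "isCont u t" if "t \<in> {x<..<y}" for t
    using that by (intro DERIV_isCont[OF du]) auto
  then have "continuous_on {x<..<y} u"
    by (intro continuous_at_imp_continuous_on) blast
  then obtain \<sigma> where \<sigma>: "\<And>t. t \<in> {x<..<y} \<Longrightarrow> \<sigma> * u t > 0"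
    using nonvanishing_imp_constant_sign nz by blast
  define W where "W t = u' t * sin (k * (t - x)) - u t * (k * cos (k * (t - x)))" for t
  have dW: "(W has_real_derivative (k\<^sup>2 - q t) * (u t * sin (k * (t - x)))) (at t)"
    if "t \<in> {x..y}" for t
    unfolding W_def[abs_def] by (rule wronskian_sin_deriv[OF du[OF that] du'[OF that]])
  have "\<sigma> * W x < \<sigma> * W y"
  proof (rule DERIV_pos_imp_increasing_open[OF \<open>x < y\<close>])
    fix t assume t: "x < t" "t < y"
    have "k * (t - x) < k * (y - x)" using k t by simp
    then have "k * (t - x) < pi" using short by linarith
    then have "sin (k * (t - x)) > 0"
      using k t by (intro sin_gt_zero) auto
    then have "0 < (k\<^sup>2 - q t) * (\<sigma> * u t * sin (k * (t - x)))"
      using \<sigma>[of t] q[of t] t k by simp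
    then show "\<exists>d. ((\<lambda>t. \<sigma> * W t) has_real_derivative d) (at t) \<and> 0 < d"
      using DERIV_cmult[OF dW[of t], of \<sigma>] t by (auto simp: mult_ac)
  next
    show "continuous_on {x..y} (\<lambda>t. \<sigma> * W t)"
      using DERIV_cmult[OF dW, of _ \<sigma>]
      by (intro continuous_at_imp_continuous_on) (blast intro: DERIV_isCont)
  qed
  moreover have "W x = 0" using \<open>u x = 0\<close> by (simp add: W_def)
  moreover have "\<sigma> * u' y \<le> 0"
  proof (rule ccontr)
    assume "\<not> \<sigma> * u' y \<le> 0"
    moreover have "((\<lambda>t. \<sigma> * u t) has_real_derivative \<sigma> * u' y) (at y)"
      using \<open>x < y\<close> by (intro DERIV_cmult du) auto
    ultimately obtain d where d: "d > 0" "\<And>h. 0 < h \<Longrightarrow> h < d \<Longrightarrow> \<sigma> * u (y - h) < \<sigma> * u y"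
      using DERIV_pos_inc_left[of "\<lambda>t. \<sigma> * u t" "\<sigma> * u' y" y] by auto
    define h where "h = min d (y - x) / 2"
    have h: "0 < h" "2 * h \<le> d" "2 * h \<le> y - x"
      using d(1) \<open>x < y\<close> by (simp_all add: h_def)
    have "h < d" using h by linarith
    moreover have "x < y - h" using h \<open>x < y\<close> by linarith
    ultimately show False using d(2)[of h] \<sigma>[of "y - h"] \<open>u y = 0\<close> h(1) by simp
  qed
  moreover have "0 \<le> sin (k * (y - x))"
    using short k \<open>x < y\<close> by (intro sin_ge_zero) auto
  ultimately show False
    using \<open>u x = 0\<close> \<open>u y = 0\<close> mult_nonpos_nonneg[of "\<sigma> * u' y" "sin (k * (y - x))"]
    by (simp add: W_def mult.assoc)
qed

lemma DERIV_neg_except_imp_decreasing: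
  fixes f :: "real \<Rightarrow> real"
  assumes "x < z" and cont: "continuous_on {x..z} f"
    and neg: "\<And>t. x < t \<Longrightarrow> t < z \<Longrightarrow> t \<noteq> p \<Longrightarrow> \<exists>d. (f has_real_derivative d) (at t) \<and> d < 0"
  shows "f z < f x"
proof (cases "x < p \<and> p < z")
  case True
  have "f p < f x"
    using True by (intro DERIV_neg_imp_decreasing_open[of x p f] neg continuous_on_subset[OF cont]) auto
  moreover have "f z < f p"
    using True by (intro DERIV_neg_imp_decreasing_open[of p z f] neg continuous_on_subset[OF cont]) auto
  ultimately show ?thesis by simp
next
  case False
  then show ?thesis
    using \<open>x < z\<close> by (intro DERIV_neg_imp_decreasing_open[of x z f] neg cont) auto
qed

text \<open>
  Again take \<open>u > 0\<close> between its zeros. The sine wave starting at \<open>x\<close> returns to zero at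
  \<open>x + \<pi> / sqrt K\<close>. If \<open>y\<close> were not to the left of that point, the Wronskian would be
  nonnegative there, although it decreases strictly from \<open>0\<close>. The exceptional point \<open>p\<close>
  makes room for comparison with a minimum value of \<open>q\<close> that is attained inside the gap.
\<close>

lemma sturm_gap_lt:
  fixes u u' q :: "real \<Rightarrow> real"
  assumes "x < y" and "K > 0"
    and du: "\<And>t. t \<in> {x..y} \<Longrightarrow> (u has_real_derivative u' t) (at t)"
    and du': "\<And>t. t \<in> {x..y} \<Longrightarrow> (u' has_real_derivative - q t * u t) (at t)"
    and "u x = 0" and "u y = 0"
    and nz: "\<And>t. t \<in> {x<..<y} \<Longrightarrow> u t \<noteq> 0"
    and q: "\<And>t. t \<in> {x<..<y} \<Longrightarrow> t \<noteq> p \<Longrightarrow> K < q t"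
  shows "y - x < pi / sqrt K"
proof (rule ccontr)
  define k where "k = sqrt K"
  have k: "k > 0" "k\<^sup>2 = K" using \<open>K > 0\<close> by (auto simp: k_def)
  define z where "z = x + pi / k"
  assume "\<not> y - x < pi / sqrt K"
  then have z: "x < z" "z \<le> y" "k * (z - x) = pi"
    using k by (auto simp: k_def[symmetric] z_def)
  have "isCont u t" if "t \<in> {x<..<y}" for t
    using that by (intro DERIV_isCont[OF du]) auto
  then have "continuous_on {x<..<y} u"
    by (intro continuous_at_imp_continuous_on) blast
  then obtain \<sigma> where \<sigma>: "\<And>t. t \<in> {x<..<y} \<Longrightarrow> \<sigma> * u t > 0"
    using nonvanishing_imp_constant_sign nz by blast
  define W where "W t = u' t * sin (k * (t - x)) - u t * (k * cos (k * (t - x)))" for t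
  have dW: "(W has_real_derivative (k\<^sup>2 - q t) * (u t * sin (k * (t - x)))) (at t)"
    if "t \<in> {x..y}" for t
    unfolding W_def[abs_def] by (rule wronskian_sin_deriv[OF du[OF that] du'[OF that]])
  have "\<sigma> * W x > \<sigma> * W z"
  proof (rule DERIV_neg_except_imp_decreasing[OF \<open>x < z\<close>, where p = p])
    have "isCont (\<lambda>t. \<sigma> * W t) t" if "t \<in> {x..z}" for t
      using DERIV_cmult[OF dW, of t \<sigma>] that z by (intro DERIV_isCont) auto
    then show "continuous_on {x..z} (\<lambda>t. \<sigma> * W t)"
      by (intro continuous_at_imp_continuous_on) blast
  next
    fix t assume t: "x < t" "t < z" "t \<noteq> p"
    have "k * (t - x) < k * (z - x)" using k t by simp
    then have "sin (k * (t - x)) > 0"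
      using z k t by (intro sin_gt_zero) auto
    then have "(k\<^sup>2 - q t) * (\<sigma> * u t * sin (k * (t - x))) < 0"
      using \<sigma>[of t] q[of t] t k z by (intro mult_neg_pos) auto
    then show "\<exists>d. ((\<lambda>t. \<sigma> * W t) has_real_derivative d) (at t) \<and> d < 0"
      using DERIV_cmult[OF dW[of t], of \<sigma>] t z by (auto simp: mult_ac)
  qed
  moreover have "W x = 0" using \<open>u x = 0\<close> by (simp add: W_def)
  moreover have "W z = u z * k" by (simp add: W_def z(3))
  moreover have "0 \<le> \<sigma> * u z"
    using \<sigma>[of z] z \<open>u y = 0\<close> by (cases "z = y") auto
  ultimately show False
    using k mult_nonneg_nonneg[of "\<sigma> * u z" k] by (simp add: mult.assoc)
qed

section \<open>Gaps between zeros of ultraspherical polynomials\<close>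

lemma F_strict_mono_abs:
  assumes "real n + \<alpha> > 0" and "\<bar>\<alpha>\<bar> \<le> 1" and "\<bar>s\<bar> < \<bar>t\<bar>" and "\<bar>t\<bar> < 1"
  shows "F n \<alpha> s < F n \<alpha> t"
proof -
  have st: "s\<^sup>2 < t\<^sup>2"
    using assms(3) by (metis abs_ge_zero power2_abs power_strict_mono pos2)
  have t: "0 < 1 - t\<^sup>2" by (rule one_minus_square_pos[OF assms(4)])
  have \<alpha>: "0 \<le> 1 - \<alpha>\<^sup>2" using assms(2) by (simp add: abs_square_le_1)
  have D: "0 < (\<alpha> + real n) * (\<alpha> + real n + 1)" using assms(1) by simp
  have "(\<alpha> + real n) * (\<alpha> + real n + 1) / (1 - s\<^sup>2) < (\<alpha> + real n) * (\<alpha> + real n + 1) / (1 - t\<^sup>2)"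
    using st t D by (intro divide_strict_left_mono) auto
  moreover have "(1 - \<alpha>\<^sup>2) / (1 - s\<^sup>2)\<^sup>2 \<le> (1 - \<alpha>\<^sup>2) / (1 - t\<^sup>2)\<^sup>2"
    using st t \<alpha> by (intro divide_left_mono power_mono mult_pos_pos zero_less_power) auto
  ultimately show ?thesis
    using F_partial_fractions[of s n \<alpha>] F_partial_fractions[of t n \<alpha>] assms(3,4) by simp
qed

lemma F_pos:
  assumes "real n + \<alpha> > 0" and "\<bar>\<alpha>\<bar> \<le> 1" and "\<bar>t\<bar> < 1"
  shows "0 < F n \<alpha> t"
proof -
  have "0 \<le> 1 - \<alpha>\<^sup>2" using assms(2) by (simp add: abs_square_le_1)
  then show ?thesis
    unfolding F_partial_fractions[OF assms(3)]
    using assms(1) one_minus_square_pos[OF assms(3)] by (intro add_pos_nonneg) auto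
qed

lemma zero_gap_gt:
  assumes "consecutive_zeros (ultraspherical n \<alpha>) (-1) 1 x y" and "K > 0"
    and "\<And>t. t \<in> {x<..<y} \<Longrightarrow> F n \<alpha> t < K"
  shows "pi / sqrt K < y - x"
proof (rule sturm_gap_gt[where u = "weighted_ultraspherical n \<alpha>"
      and u' = "weighted_ultraspherical_deriv n \<alpha>" and q = "F n \<alpha>"])
  fix t assume "t \<in> {x<..<y}"
  with assms(1) have "\<bar>t\<bar> < 1" "ultraspherical n \<alpha> t \<noteq> 0"
    by (auto simp: consecutive_zeros_def)
  then show "weighted_ultraspherical n \<alpha> t \<noteq> 0"
    using one_minus_square_pos[of t] by (simp add: weighted_ultraspherical_def)
qed (use assms in \<open>auto simp: consecutive_zeros_def weighted_ultraspherical_def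
      intro!: has_derivative_weighted_ultraspherical normal_form[simplified]\<close>)

lemma zero_gap_lt:
  assumes "consecutive_zeros (ultraspherical n \<alpha>) (-1) 1 x y" and "K > 0"
    and "\<And>t. t \<in> {x<..<y} \<Longrightarrow> t \<noteq> p \<Longrightarrow> K < F n \<alpha> t"
  shows "y - x < pi / sqrt K"
proof (rule sturm_gap_lt[where u = "weighted_ultraspherical n \<alpha>"
      and u' = "weighted_ultraspherical_deriv n \<alpha>" and q = "F n \<alpha>" and p = p])
  fix t assume "t \<in> {x<..<y}"
  with assms(1) have "\<bar>t\<bar> < 1" "ultraspherical n \<alpha> t \<noteq> 0"
    by (auto simp: consecutive_zeros_def)
  then show "weighted_ultraspherical n \<alpha> t \<noteq> 0"
    using one_minus_square_pos[of t] by (simp add: weighted_ultraspherical_def)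
qed (use assms in \<open>auto simp: consecutive_zeros_def weighted_ultraspherical_def
      intro!: has_derivative_weighted_ultraspherical normal_form[simplified]\<close>)

lemma consecutive_zeros_mono:
  "consecutive_zeros f a b x y \<Longrightarrow> c \<le> a \<Longrightarrow> b \<le> d \<Longrightarrow> consecutive_zeros f c d x y"
  by (auto simp: consecutive_zeros_def)

theorem theorem5p1:
  fixes n :: nat and \<alpha> :: real
  assumes "n \<ge> 1" and "real n + \<alpha> > 0" and "real n + 2 * \<alpha> > 0"
    and "\<bar>\<alpha>\<bar> \<le> 1"
  shows "zeros_convex_on (ultraspherical n \<alpha>) (-1) 0
    \<and> zeros_concave_on (ultraspherical n \<alpha>) 0 1
    \<and> pi / sqrt (F n \<alpha> 0) = pi / sqrt (2 * \<alpha> * real n + \<alpha> + (real n)\<^sup>2 + real n + 1)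
    \<and> (\<forall>x y. consecutive_zeros (ultraspherical n \<alpha>) (-1) 1 x y \<longrightarrow>
          y - x < pi / sqrt (F n \<alpha> 0))
    \<and> (\<forall>x y. consecutive_zeros (ultraspherical n \<alpha>) (-1) 1 x y \<and> 0 < x \<longrightarrow>
          pi / sqrt (F n \<alpha> y) < y - x \<and> y - x < pi / sqrt (F n \<alpha> x))"
proof -
  let ?P = "ultraspherical n \<alpha>"
  note mono = F_strict_mono_abs[OF assms(2,4)]
  note pos = F_pos[OF assms(2,4)]
  have global: "y - x < pi / sqrt (F n \<alpha> 0)" if "consecutive_zeros ?P (-1) 1 x y" for x y
    \<comment> \<open>The gap may contain the origin, the only point where \<open>F\<close> takes the value \<open>F 0\<close>.\<close>
  proof (rule zero_gap_lt[OF that, where p = 0])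
    show "F n \<alpha> 0 < F n \<alpha> t" if "t \<in> {x<..<y}" "t \<noteq> 0" for t
      using that \<open>consecutive_zeros ?P (-1) 1 x y\<close>
      by (intro mono) (auto simp: consecutive_zeros_def)
  qed (simp add: pos)
  have positive: "pi / sqrt (F n \<alpha> y) < y - x \<and> y - x < pi / sqrt (F n \<alpha> x)"
    if "consecutive_zeros ?P (-1) 1 x y" "0 \<le> x" for x y
  proof -
    have xy: "\<bar>x\<bar> < 1" "\<bar>y\<bar> < 1" using that by (auto simp: consecutive_zeros_def)
    have "F n \<alpha> x < F n \<alpha> t" "F n \<alpha> t < F n \<alpha> y" if "t \<in> {x<..<y}" for t
      using that xy \<open>0 \<le> x\<close> by (auto intro!: mono)
    then show ?thesis
      using zero_gap_gt[OF that(1) pos[OF xy(2)]] zero_gap_lt[OF that(1) pos[OF xy(1)]] by blast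
  qed
  have negative: "pi / sqrt (F n \<alpha> x) < y - x \<and> y - x < pi / sqrt (F n \<alpha> y)"
    if "consecutive_zeros ?P (-1) 1 x y" "y \<le> 0" for x y
  proof -
    have xy: "\<bar>x\<bar> < 1" "\<bar>y\<bar> < 1" using that by (auto simp: consecutive_zeros_def)
    have "F n \<alpha> t < F n \<alpha> x" "F n \<alpha> y < F n \<alpha> t" if "t \<in> {x<..<y}" for t
      using that xy \<open>y \<le> 0\<close> by (auto intro!: mono)
    then show ?thesis
      using zero_gap_gt[OF that(1) pos[OF xy(1)]] zero_gap_lt[OF that(1) pos[OF xy(2)]] by blast
  qed
  have convex: "zeros_convex_on ?P (-1) 0"
    unfolding zeros_convex_on_def
  proof (intro allI impI, elim conjE)
    fix x y z assume xy: "consecutive_zeros ?P (-1) 0 x y" and yz: "consecutive_zeros ?P (-1) 0 y z"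
    have "y \<le> 0" "z \<le> 0" using yz by (auto simp: consecutive_zeros_def)
    then show "z - y > y - x"
      using negative[OF consecutive_zeros_mono[OF xy]] negative[OF consecutive_zeros_mono[OF yz]]
      by simp
  qed
  have concave: "zeros_concave_on ?P 0 1"
    unfolding zeros_concave_on_def
  proof (intro allI impI, elim conjE)
    fix x y z assume xy: "consecutive_zeros ?P 0 1 x y" and yz: "consecutive_zeros ?P 0 1 y z"
    have "0 \<le> x" "0 \<le> y" using xy by (auto simp: consecutive_zeros_def)
    then show "z - y < y - x"
      using positive[OF consecutive_zeros_mono[OF xy]] positive[OF consecutive_zeros_mono[OF yz]]
      by simp
  qed
  have "F n \<alpha> 0 = 2 * \<alpha> * real n + \<alpha> + (real n)\<^sup>2 + real n + 1"
    by (simp add: F_def)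
  then show ?thesis
    using convex concave global positive by simp
qed

end
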